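(* Let $\widehat{X}$ be a sandpile graph such that $\mathcal{M}(\widehat{X})$ has exactly two idempotents, and let $a\in\mathcal{M}(\widehat{X})$. If $a$ has a grain of sand on a vertex from which a cycle in $X$ is accessible, then the sequence $a,\ a\oplus a,\ a\oplus a\oplus a,\dots$ eventually reaches a recurrent configuration. Conversely, if $a$ has no sand on any vertex from which a cycle in $X$ is accessible, then no term of this sequence is recurrent.
   Context: A sandpile graph $\widehat{X}$ is a finite weakly connected directed multigraph (loops and multiple edges allowed) with a distinguished vertex, the sink, reachable by a directed path from every vertex; the set $V$ of non-sink vertices is nonempty, and $X$ is the digraph obtained from $\widehat X$ by deleting the sink (edge set $E$). A configuration assigns a nonnegative integer number of grains to each non-sink vertex; it is stable if every $v$ holds fewer than $\deg^{+}(v)$ (out-degree) grains. Toppling an unstable vertex sends one grain along each of its out-edges (grains at the sink vanish; the sink never topples); every configuration has a unique stabilization. $\mathcal{M}(\widehat X)$ is the set of stable configurations with $a\oplus b$ = stabilization of $a+b$ (commutative monoid, identity $0$). $a$ is accessible from $b$ if $b\oplus x=a$ for some $x$; $a$ is recurrent if accessible from every element. A cycle is a directed closed path of length $\ge1$ in $X$; a cycle is accessible from a vertex $v$ if there is a directed path from $v$ to a vertex of the cycle using only edges of $E$. *)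

theory Defs
  imports "Graph_Theory.Graph_Theory" "HOL-Algebra.Group"
begin

text \<open>
  Arcs are abstract objects with a tail and a head, so \<^locale>\<open>fin_digraph\<close> allows loops and
  parallel arcs; \<^const>\<open>connected\<close> is weak connectedness. Arcs leaving the sink are allowed.
\<close>

locale sandpile_graph = fin_digraph G for G :: "('a, 'b) pre_digraph" (structure) +
  fixes s :: 'a
  assumes sink_in_verts: "s \<in> verts G"
    and weakly_connected: "connected G"
    and sink_reachable: "\<And>v. v \<in> verts G \<Longrightarrow> v \<rightarrow>\<^sup>*\<^bsub>G\<^esub> s"
    and nonsink_nonempty: "verts G - {s} \<noteq> {}"

abbreviation nonsink :: "('a, 'b) pre_digraph \<Rightarrow> 'a \<Rightarrow> 'a set" where
  "nonsink G s \<equiv> verts G - {s}"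

text \<open>
  A function on the non-sink vertices is represented by its extension by \<open>0\<close> to the whole type.
\<close>

definition configurations :: "('a, 'b) pre_digraph \<Rightarrow> 'a \<Rightarrow> ('a \<Rightarrow> nat) set" where
  "configurations G s = {c. \<forall>v. v \<notin> nonsink G s \<longrightarrow> c v = 0}"

definition stable :: "('a, 'b) pre_digraph \<Rightarrow> 'a \<Rightarrow> ('a \<Rightarrow> nat) \<Rightarrow> bool" where
  "stable G s c \<longleftrightarrow> (\<forall>v \<in> nonsink G s. c v < out_degree G v)"

text \<open>
  The out-degree is taken in the whole graph, and a loop at \<open>v\<close> returns its grain to \<open>v\<close>. The
  subtraction is only used when \<open>c v \<ge> out_degree G v\<close>, so it does not truncate.
\<close>

definition topple :: "('a, 'b) pre_digraph \<Rightarrow> 'a \<Rightarrow> 'a \<Rightarrow> ('a \<Rightarrow> nat) \<Rightarrow> ('a \<Rightarrow> nat)" where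
  "topple G s v c =
     (\<lambda>w. if w \<in> nonsink G s
          then (if w = v then c w - out_degree G v else c w)
               + card {e \<in> out_arcs G v. head G e = w}
          else 0)"

inductive toppling :: "('a, 'b) pre_digraph \<Rightarrow> 'a \<Rightarrow> ('a \<Rightarrow> nat) \<Rightarrow> ('a \<Rightarrow> nat) \<Rightarrow> bool"
  for G s where
  "v \<in> nonsink G s \<Longrightarrow> out_degree G v \<le> c v \<Longrightarrow> toppling G s c (topple G s v c)"

definition stabilization :: "('a, 'b) pre_digraph \<Rightarrow> 'a \<Rightarrow> ('a \<Rightarrow> nat) \<Rightarrow> ('a \<Rightarrow> nat)" where
  "stabilization G s c = (THE d. (toppling G s)\<^sup>*\<^sup>* c d \<and> stable G s d)"

definition sandpile_monoid :: "('a, 'b) pre_digraph \<Rightarrow> 'a \<Rightarrow> ('a \<Rightarrow> nat) monoid" where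
  "sandpile_monoid G s =
     \<lparr>carrier = {c \<in> configurations G s. stable G s c},
      mult = (\<lambda>a b. stabilization G s (\<lambda>v. a v + b v)),
      one = (\<lambda>v. 0)\<rparr>"

definition idempotents :: "('c, 'd) monoid_scheme \<Rightarrow> 'c set" where
  "idempotents M = {e \<in> carrier M. e \<otimes>\<^bsub>M\<^esub> e = e}"

definition accessible_from :: "('c, 'd) monoid_scheme \<Rightarrow> 'c \<Rightarrow> 'c \<Rightarrow> bool" where
  "accessible_from M b a \<longleftrightarrow> (\<exists>x \<in> carrier M. b \<otimes>\<^bsub>M\<^esub> x = a)"

definition recurrent :: "('c, 'd) monoid_scheme \<Rightarrow> 'c \<Rightarrow> bool" where
  "recurrent M a \<longleftrightarrow> a \<in> carrier M \<and> (\<forall>b \<in> carrier M. accessible_from M b a)"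

text \<open>
  A cycle is a list of arcs; since it is closed, its vertices are exactly the tails of its arcs.
\<close>

definition cycle_accessible_from :: "('a, 'b) pre_digraph \<Rightarrow> 'a \<Rightarrow> bool" where
  "cycle_accessible_from X v \<longleftrightarrow>
     (\<exists>p u. pre_digraph.cycle X p \<and> u \<in> tail X ` set p \<and> v \<rightarrow>\<^sup>*\<^bsub>X\<^esub> u)"

end

theory Submission
  imports Defs "HOL-Algebra.FiniteProduct" "HOL-Library.Confluence"
begin

text \<open>
  In a finite commutative monoid every element has an idempotent power, and some idempotent is
  recurrent. When there are exactly two idempotents, the recurrent one is not the identity \<open>0\<close>, so
  some multiple of \<open>a\<close> is recurrent unless the idempotent multiple of \<open>a\<close> is \<open>0\<close>. Toppling keeps a
  grain on a vertex with an accessible cycle whenever there is one, which excludes \<open>0\<close>. If no grain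
  lies on such a vertex, then all toppling takes place on an acyclic part of the graph; following
  the number of topplings along this part from its sources on shows that the only idempotent
  supported there is \<open>0\<close>.
\<close>

section \<open>Idempotent and recurrent elements of finite commutative monoids\<close>

context comm_monoid
begin

text \<open>By pigeonhole two powers of \<open>x\<close> coincide, so the powers are periodic with
  period \<open>p\<close> from exponent \<open>i\<close> on; an exponent past \<open>i\<close> that
  is divisible by \<open>p\<close> gives an idempotent.\<close>

lemma exists_idempotent_pow:
  assumes fin: "finite (carrier G)" and x: "x \<in> carrier G"
  shows "\<exists>n\<ge>1. x [^] (n::nat) \<in> idempotents G"
proof -
  have "\<not> inj (\<lambda>n::nat. x [^] n)"
    using finite_subset[OF _ fin, of "range (\<lambda>n::nat. x [^] n)"] x finite_imageD by fastforce
  then obtain i j :: nat where ij: "i < j" "x [^] i = x [^] j"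
    unfolding inj_def by (metis linorder_neqE_nat)
  define p where "p = j - i"
  have p: "p \<ge> 1" "x [^] (i + p) = x [^] i" using ij by (simp_all add: p_def)
  have shift: "x [^] (k + p) = x [^] k" if "k \<ge> i" for k
  proof -
    have "x [^] (k + p) = x [^] (i + p) \<otimes> x [^] (k - i)"
      using x that by (simp add: nat_pow_mult add.commute)
    also have "\<dots> = x [^] i \<otimes> x [^] (k - i)" using p by simp
    also have "\<dots> = x [^] k" using x that by (simp add: nat_pow_mult)
    finally show ?thesis .
  qed
  have shifts: "x [^] (k + m * p) = x [^] k" if "k \<ge> i" for k m
  proof (induction m)
    case (Suc m)
    have "x [^] (k + Suc m * p) = x [^] (k + m * p + p)" by (simp add: algebra_simps)
    also have "\<dots> = x [^] k" using shift[of "k + m * p"] that Suc by simp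
    finally show ?case .
  qed simp
  \<comment> \<open>Divisible by \<open>p\<close> and larger than \<open>i\<close>; the factor
    \<open>Suc i\<close> keeps \<open>n\<close> positive even when \<open>i = 0\<close>.\<close>
  define n where "n = Suc i * p"
  have "n \<ge> Suc i" using p(1) unfolding n_def by (cases p) simp_all
  then have "x [^] (n + n) = x [^] n" using shifts[of n "Suc i"] by (simp add: n_def)
  then have "x [^] n \<in> idempotents G" using x by (simp add: idempotents_def nat_pow_mult)
  with \<open>n \<ge> Suc i\<close> show ?thesis by (intro exI[of _ n]) simp
qed

text \<open>Recurrent elements form an ideal: multiply a witness of accessibility by
  \<open>x\<close>.\<close>

lemma recurrent_mult:
  assumes "recurrent G r" and x: "x \<in> carrier G"
  shows "recurrent G (r \<otimes> x)"
  unfolding recurrent_def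
proof (intro conjI ballI)
  show "r \<otimes> x \<in> carrier G" using assms by (simp add: recurrent_def)
next
  fix b assume b: "b \<in> carrier G"
  then obtain y where "y \<in> carrier G" "b \<otimes> y = r"
    using assms by (auto simp: recurrent_def accessible_from_def)
  then show "accessible_from G b (r \<otimes> x)"
    unfolding accessible_from_def using b x by (intro bexI[of _ "y \<otimes> x"]) (auto simp: m_assoc)
qed

lemma recurrent_pow:
  assumes r: "recurrent G r" and "n \<ge> 1"
  shows "recurrent G (r [^] (n::nat))"
proof -
  obtain m where "n = Suc m" using assms(2) by (cases n) auto
  moreover have "r \<in> carrier G" using r by (simp add: recurrent_def)
  ultimately show ?thesis using recurrent_mult[OF r, of "r [^] m"] by (simp add: m_comm)
qed

text \<open>The product of all elements is a multiple of each of them, so it is accessible from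
  each.\<close>

lemma exists_recurrent:
  assumes fin: "finite (carrier G)"
  shows "\<exists>r. recurrent G r"
proof -
  let ?r = "finprod G (\<lambda>x. x) (carrier G)"
  have "accessible_from G b ?r" if b: "b \<in> carrier G" for b
  proof -
    have "?r = finprod G (\<lambda>x. x) (insert b (carrier G - {b}))" using b by (simp add: insert_absorb)
    also have "\<dots> = b \<otimes> finprod G (\<lambda>x. x) (carrier G - {b})"
      using fin b by (intro finprod_insert) auto
    finally show ?thesis unfolding accessible_from_def
      by (intro bexI[of _ "finprod G (\<lambda>x. x) (carrier G - {b})"]) auto
  qed
  then have "recurrent G ?r" by (simp add: recurrent_def)
  then show ?thesis ..
qed

lemma exists_recurrent_idempotent:
  assumes fin: "finite (carrier G)"
  shows "\<exists>e\<in>idempotents G. recurrent G e"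
proof -
  obtain r where r: "recurrent G r" using exists_recurrent[OF fin] ..
  then have "r \<in> carrier G" by (simp add: recurrent_def)
  then show ?thesis using exists_idempotent_pow[OF fin] recurrent_pow[OF r] by blast
qed

text \<open>Every element divides a recurrent identity, hence is a unit, and an idempotent unit is
  the identity.\<close>

lemma one_recurrent_imp_idempotents:
  assumes one: "recurrent G \<one>"
  shows "idempotents G = {\<one>}"
proof -
  have "f = \<one>" if f: "f \<in> carrier G" "f \<otimes> f = f" for f
  proof -
    obtain x where x: "x \<in> carrier G" "f \<otimes> x = \<one>"
      using one f by (auto simp: recurrent_def accessible_from_def)
    have "f = f \<otimes> (f \<otimes> x)" using x f by simp
    also have "\<dots> = (f \<otimes> f) \<otimes> x" using x f by (intro m_assoc[symmetric])
    also have "\<dots> = \<one>" using x f by simp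
    finally show ?thesis .
  qed
  then show ?thesis by (auto simp: idempotents_def)
qed

text \<open>The identity and a recurrent idempotent are distinct, so they exhaust the
  idempotents.\<close>

lemma two_idempotents_recurrent:
  assumes fin: "finite (carrier G)" and two: "card (idempotents G) = 2"
  shows "\<not> recurrent G \<one>"
    and "\<And>f. f \<in> idempotents G \<Longrightarrow> f \<noteq> \<one> \<Longrightarrow> recurrent G f"
proof -
  show not: "\<not> recurrent G \<one>" using one_recurrent_imp_idempotents two by auto
  fix f assume f: "f \<in> idempotents G" "f \<noteq> \<one>"
  obtain e where e: "e \<in> idempotents G" "recurrent G e"
    using exists_recurrent_idempotent[OF fin] by blast
  have "\<one> \<in> idempotents G" by (simp add: idempotents_def)
  moreover have "e \<noteq> \<one>" using e not by auto
  ultimately have "e = f" using e(1) f two by (auto simp: card_2_iff)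
  then show "recurrent G f" using e by simp
qed

end

section \<open>Accessible cycles\<close>

context wf_digraph
begin

text \<open>The predicate \<open>cycle\<close> forbids repeated vertices apart from the endpoint, so
  a closed walk is shortened: a repetition cuts out a shorter closed subwalk, reachable along the
  initial segment.\<close>

lemma closed_walk_reaches_cycle:
  assumes "awalk u p u" and "p \<noteq> []"
  shows "\<exists>q w. cycle q \<and> w \<in> tail G ` set q \<and> u \<rightarrow>\<^sup>* w"
  using assms
proof (induction "length p" arbitrary: u p rule: less_induct)
  case less
  obtain e es where p: "p = e # es" using less.prems by (cases p) auto
  have e: "tail G e = u" "e \<in> arcs G" "awalk (head G e) es u"
    using less.prems p by (auto simp: awalk_Cons_iff)
  show ?case
  proof (cases "distinct (tl (awalk_verts u p))")
    case True
    then have "cycle p" using less.prems by (auto simp: cycle_def)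
    moreover have "u \<rightarrow>\<^sup>* u" using less.prems by (auto intro: reachable_awalkI)
    ultimately show ?thesis using p e by (intro exI[of _ p] exI[of _ u]) auto
  next
    case False
    then have "\<not> distinct (awalk_verts (head G e) es)" by (simp add: p)
    then obtain q r t w where dec: "es = q @ r @ t" "r \<noteq> []"
        "awalk (head G e) q w" "awalk w r w"
      using awalk_not_distinct_decomp[OF e(3)] by auto
    then have "length r < length p" using p by simp
    then obtain q' w' where w': "cycle q'" "w' \<in> tail G ` set q'" "w \<rightarrow>\<^sup>* w'"
      using less.hyps dec by blast
    have "awalk u (e # q) w" using dec e by (simp add: awalk_Cons_iff)
    then have "u \<rightarrow>\<^sup>* w" by (rule reachable_awalkI)
    then show ?thesis using w' reachable_trans by blast
  qed
qed

text \<open>Trades lists of arcs for reachability, where accessible cycles can be pushed along arcs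
  by transitivity.\<close>

lemma cycle_accessible_iff:
  "cycle_accessible_from G v \<longleftrightarrow> (\<exists>u. v \<rightarrow>\<^sup>* u \<and> u \<rightarrow>\<^sup>+ u)"
proof
  assume "cycle_accessible_from G v"
  then obtain p u where p: "cycle p" "u \<in> tail G ` set p" "v \<rightarrow>\<^sup>* u"
    by (auto simp: cycle_accessible_from_def)
  then obtain x where x: "awalk x p x" by (auto simp: cycle_def)
  obtain e where e: "e \<in> set p" "tail G e = u" using p by auto
  \<comment> \<open>Cutting at an arc that leaves \<open>u\<close> splits the cycle into a nonempty
    walk from \<open>u\<close> to \<open>x\<close> and a walk back to \<open>u\<close>.\<close>
  then obtain q r where "p = q @ e # r" by (meson split_list)
  then have "awalk x q u" "awalk u (e # r) x" using x e by (auto simp: awalk_Cons_iff)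
  then have "u \<rightarrow>\<^sup>+ x" "x \<rightarrow>\<^sup>* u" by (auto intro: reachable1_awalkI reachable_awalkI)
  then have "u \<rightarrow>\<^sup>+ u" by (rule reachable1_reachable_trans)
  then show "\<exists>u. v \<rightarrow>\<^sup>* u \<and> u \<rightarrow>\<^sup>+ u" using p by blast
next
  assume "\<exists>u. v \<rightarrow>\<^sup>* u \<and> u \<rightarrow>\<^sup>+ u"
  then obtain u where u: "v \<rightarrow>\<^sup>* u" "u \<rightarrow>\<^sup>+ u" by blast
  then obtain p where "awalk u p u" "p \<noteq> []" by (auto simp: reachable1_awalk)
  then obtain q w where "cycle q" "w \<in> tail G ` set q" "u \<rightarrow>\<^sup>* w"
    using closed_walk_reaches_cycle by blast
  moreover have "v \<rightarrow>\<^sup>* w" using u(1) \<open>u \<rightarrow>\<^sup>* w\<close> by (rule reachable_trans)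
  ultimately show "cycle_accessible_from G v" unfolding cycle_accessible_from_def by blast
qed

lemma cycle_accessible_backward:
  assumes "u \<rightarrow> v" and "cycle_accessible_from G v"
  shows "cycle_accessible_from G u"
proof -
  obtain w where "v \<rightarrow>\<^sup>* w" "w \<rightarrow>\<^sup>+ w" using assms(2) by (auto simp: cycle_accessible_iff)
  moreover have "u \<rightarrow>\<^sup>* w" using assms(1) \<open>v \<rightarrow>\<^sup>* w\<close> by (rule adj_reachable_trans)
  ultimately show ?thesis by (auto simp: cycle_accessible_iff)
qed

lemma cycle_accessible_forward:
  assumes "cycle_accessible_from G v"
  shows "\<exists>w. v \<rightarrow> w \<and> cycle_accessible_from G w"
proof -
  obtain u where u: "v \<rightarrow>\<^sup>* u" "u \<rightarrow>\<^sup>+ u" using assms by (auto simp: cycle_accessible_iff)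
  \<comment> \<open>Appending the closed walk at \<open>u\<close> makes the path nonempty even if
    \<open>v = u\<close>, so it has a first arc.\<close>
  then have "v \<rightarrow>\<^sup>+ u" by (rule reachable_reachable1_trans)
  then obtain w where w: "v \<rightarrow> w" "(w, u) \<in> (arcs_ends G)\<^sup>*" by (meson tranclD)
  have "w \<in> verts G" using w by (auto simp: adj_in_verts)
  then have "w \<rightarrow>\<^sup>* u" using w by (simp add: reachable_conv')
  then show ?thesis using u w by (auto simp: cycle_accessible_iff)
qed

end

section \<open>Stabilization\<close>

lemma stable_no_toppling: "stable G s c \<Longrightarrow> \<not> toppling G s c d"
  by (metis not_less stable_def toppling.cases)

context sandpile_graph
begin

abbreviation arc_count :: "'a \<Rightarrow> 'a \<Rightarrow> nat" where
  "arc_count v w \<equiv> card {e \<in> out_arcs G v. head G e = w}"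

abbreviation \<M> :: "('a \<Rightarrow> nat) monoid" where
  "\<M> \<equiv> sandpile_monoid G s"

text \<open>\<open>del_vert s\<close> is the digraph without the sink, so both the cycle and the
  path to it avoid the sink.\<close>

abbreviation feeds_cycle :: "'a \<Rightarrow> bool" where
  "feeds_cycle \<equiv> cycle_accessible_from (del_vert s)"

lemma arc_count_pos_iff: "0 < arc_count v w \<longleftrightarrow> v \<rightarrow> w"
proof -
  have "0 < arc_count v w \<longleftrightarrow> {e \<in> out_arcs G v. head G e = w} \<noteq> {}"
    by (simp add: card_gt_0_iff)
  also have "\<dots> \<longleftrightarrow> v \<rightarrow> w"
    by (auto simp: arcs_ends_def arc_to_ends_def out_arcs_def image_iff)
  finally show ?thesis .
qed

lemma dominates_del_sink_iff:
  "v \<rightarrow>\<^bsub>del_vert s\<^esub> w \<longleftrightarrow> v \<rightarrow> w \<and> v \<noteq> s \<and> w \<noteq> s"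
  by (auto simp: arcs_ends_def arc_to_ends_def del_vert_simps image_iff)

section \<open>Termination of toppling\<close>

lemma exists_distance_to_sink:
  "\<exists>\<delta> :: 'a \<Rightarrow> nat. \<forall>v\<in>nonsink G s. \<exists>e\<in>out_arcs G v. \<delta> v = Suc (\<delta> (head G e))"
proof -
  \<comment> \<open>The length of a shortest path to the sink; the first arc of such a path lowers
    it by exactly one.\<close>
  define \<delta> where "\<delta> v = (LEAST n. (v, s) \<in> arcs_ends G ^^ n)" for v
  have "\<exists>e\<in>out_arcs G v. \<delta> v = Suc (\<delta> (head G e))" if v: "v \<in> nonsink G s" for v
  proof -
    have reach: "\<exists>n. (u, s) \<in> arcs_ends G ^^ n" if "u \<in> verts G" for u
      using sink_reachable[OF that] by (auto dest: reachable_rtranclI simp: rtrancl_power)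
    have "(v, s) \<in> arcs_ends G ^^ \<delta> v"
      using reach[of v] v unfolding \<delta>_def by (auto intro: LeastI_ex)
    moreover have "\<delta> v \<noteq> 0" using calculation v by (cases "\<delta> v") auto
    ultimately obtain m where m: "\<delta> v = Suc m" "(v, s) \<in> arcs_ends G ^^ Suc m"
      by (metis not0_implies_Suc)
    then obtain w where w: "v \<rightarrow> w" "(w, s) \<in> arcs_ends G ^^ m" by (meson relpow_Suc_D2)
    then obtain e where e: "e \<in> out_arcs G v" "head G e = w"
      by (auto simp: arcs_ends_def arc_to_ends_def out_arcs_def)
    have "\<delta> w \<le> m" using w(2) unfolding \<delta>_def by (rule Least_le)
    moreover have "(w, s) \<in> arcs_ends G ^^ \<delta> w" using w(2) unfolding \<delta>_def by (rule LeastI)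
    then have "(v, s) \<in> arcs_ends G ^^ Suc (\<delta> w)" using w(1) by (meson relpow_Suc_I2)
    then have "\<delta> v \<le> Suc (\<delta> w)" unfolding \<delta>_def by (rule Least_le)
    ultimately show ?thesis using e m by auto
  qed
  then show ?thesis by blast
qed

text \<open>Makes the zero configuration stable, and ensures that a vertex that topples carries
  sand.\<close>

lemma out_degree_pos:
  assumes "v \<in> nonsink G s"
  shows "0 < out_degree G v"
  using exists_distance_to_sink assms unfolding out_degree_def card_gt_0_iff by auto

text \<open>
  With \<open>M\<close> larger than every out-degree and \<open>\<delta>\<close> the distance to the sink, the function
  \<open>W v = M ^ N - M ^ (N - \<delta> v)\<close> is strictly superharmonic away from the sink: the one head closer to
  the sink outweighs all other heads together.
\<close>

lemma exists_superharmonic_weight: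
  "\<exists>W :: 'a \<Rightarrow> nat. \<forall>v\<in>nonsink G s.
     (\<Sum>e | e \<in> out_arcs G v \<and> head G e \<noteq> s. W (head G e)) < out_degree G v * W v"
proof -
  obtain \<delta> :: "'a \<Rightarrow> nat" where
    \<delta>: "\<And>v. v \<in> nonsink G s \<Longrightarrow> \<exists>e\<in>out_arcs G v. \<delta> v = Suc (\<delta> (head G e))"
    using exists_distance_to_sink by blast
  define N where "N = Max (\<delta> ` verts G)"
  have N: "\<delta> v \<le> N" if "v \<in> verts G" for v using that by (simp add: N_def)
  define M where "M = Suc (card (arcs G))"
  define z where "z v = M ^ (N - \<delta> v)" for v
  define W where "W v = M ^ N - z v" for v
  have Wz: "W v + z v = M ^ N" for v
  proof -
    have "z v \<le> M ^ N" unfolding z_def by (rule power_increasing) (auto simp: M_def)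
    then show ?thesis by (simp add: W_def)
  qed
  have "(\<Sum>e | e \<in> out_arcs G v \<and> head G e \<noteq> s. W (head G e)) < out_degree G v * W v"
    if v: "v \<in> nonsink G s" for v
  proof -
    obtain e where e: "e \<in> out_arcs G v" "\<delta> v = Suc (\<delta> (head G e))" using \<delta>[OF v] by blast
    \<comment> \<open>The bound \<open>N\<close> keeps the subtractions exact; one step nearer to
      the sink, \<open>z\<close> grows by the factor \<open>M\<close>.\<close>
    have exp: "N - \<delta> (head G e) = Suc (N - \<delta> v)" using e N[of v] v by simp
    have "out_degree G v < M"
      unfolding out_degree_def M_def less_Suc_eq_le by (intro card_mono) (auto simp: out_arcs_def)
    moreover have "0 < M" by (simp add: M_def)
    ultimately have "out_degree G v * z v < z (head G e)"
      unfolding z_def exp by simp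
    also have "\<dots> \<le> (\<Sum>e\<in>out_arcs G v. z (head G e))"
      using e by (intro member_le_sum) auto
    finally have z: "out_degree G v * z v < (\<Sum>e\<in>out_arcs G v. z (head G e))" .
    \<comment> \<open>\<open>W + z\<close> is constant, so the strict lower bound for the sum of
      \<open>z\<close> becomes a strict upper bound for the sum of \<open>W\<close>.\<close>
    have "(\<Sum>e\<in>out_arcs G v. W (head G e)) + (\<Sum>e\<in>out_arcs G v. z (head G e))
        = out_degree G v * (W v + z v)"
      by (simp add: sum.distrib[symmetric] Wz out_degree_def)
    then have "(\<Sum>e\<in>out_arcs G v. W (head G e)) < out_degree G v * W v"
      using z by (simp add: algebra_simps)
    moreover have "(\<Sum>e | e \<in> out_arcs G v \<and> head G e \<noteq> s. W (head G e))
        \<le> (\<Sum>e\<in>out_arcs G v. W (head G e))"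
      by (intro sum_mono2) auto
    ultimately show ?thesis by simp
  qed
  then show ?thesis by blast
qed

text \<open>Groups arcs by head, linking the multiplicities in \<open>topple\<close> to sums over
  arcs.\<close>

lemma sum_arc_count:
  fixes W :: "'a \<Rightarrow> nat"
  shows "(\<Sum>w\<in>nonsink G s. arc_count v w * W w)
       = (\<Sum>e | e \<in> out_arcs G v \<and> head G e \<noteq> s. W (head G e))"
proof -
  have "(\<Sum>e | e \<in> out_arcs G v \<and> head G e \<noteq> s. W (head G e))
      = (\<Sum>w\<in>nonsink G s. \<Sum>e | e \<in> {e \<in> out_arcs G v. head G e \<noteq> s} \<and> head G e = w. W (head G e))"
    by (rule sum.group[symmetric]) (auto simp: out_arcs_def)
  also have "\<dots> = (\<Sum>w\<in>nonsink G s. arc_count v w * W w)"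
  proof (rule sum.cong[OF refl])
    fix w assume w: "w \<in> nonsink G s"
    have "{e. e \<in> {e \<in> out_arcs G v. head G e \<noteq> s} \<and> head G e = w}
        = {e \<in> out_arcs G v. head G e = w}"
      using w by auto
    then show "(\<Sum>e | e \<in> {e \<in> out_arcs G v. head G e \<noteq> s} \<and> head G e = w. W (head G e))
        = arc_count v w * W w"
      by simp
  qed
  finally show ?thesis by simp
qed

text \<open>By superharmonicity each toppling strictly lowers the total weight of the sand; the
  relation is reversed so that successors are the smaller elements.\<close>

lemma toppling_terminates: "wfP (\<lambda>d c. toppling G s c d)"
proof -
  obtain W :: "'a \<Rightarrow> nat" where W: "\<And>v. v \<in> nonsink G s \<Longrightarrow>
      (\<Sum>e | e \<in> out_arcs G v \<and> head G e \<noteq> s. W (head G e)) < out_degree G v * W v"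
    using exists_superharmonic_weight by blast
  define \<Phi> where "\<Phi> c = (\<Sum>w\<in>nonsink G s. c w * W w)" for c :: "'a \<Rightarrow> nat"
  have "\<Phi> d < \<Phi> c" if "toppling G s c d" for c d
    using that
  proof cases
    case (1 v)
    \<comment> \<open>The weight leaving \<open>v\<close> stays on the left, which avoids
      subtraction of naturals.\<close>
    have "\<Phi> d + out_degree G v * W v
        = (\<Sum>w\<in>nonsink G s. d w * W w + (if w = v then out_degree G v * W v else 0))"
      using 1 by (simp add: \<Phi>_def sum.distrib sum.delta)
    also have "\<dots> = (\<Sum>w\<in>nonsink G s. c w * W w + arc_count v w * W w)"
      using 1 by (intro sum.cong) (auto simp: topple_def algebra_simps add_mult_distrib[symmetric])
    also have "\<dots> = \<Phi> c + (\<Sum>w\<in>nonsink G s. arc_count v w * W w)"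
      by (simp add: \<Phi>_def sum.distrib)
    finally show ?thesis using W[OF 1(2)] unfolding sum_arc_count by linarith
  qed
  then show ?thesis
    using wfp_if_convertible_to_nat[of "\<lambda>d c. toppling G s c d" \<Phi>] by blast
qed

section \<open>Confluence and uniqueness of the stabilization\<close>

lemma toppling_commute:
  assumes "v \<noteq> w" "v \<in> nonsink G s" "w \<in> nonsink G s"
    and "out_degree G v \<le> c v" "out_degree G w \<le> c w"
  shows "topple G s w (topple G s v c) = topple G s v (topple G s w c)"
    and "toppling G s (topple G s v c) (topple G s w (topple G s v c))"
proof -
  show "topple G s w (topple G s v c) = topple G s v (topple G s w c)"
    using assms by (auto simp: topple_def fun_eq_iff)
  have "out_degree G w \<le> topple G s v c w" using assms by (simp add: topple_def)
  with assms(3) show "toppling G s (topple G s v c) (topple G s w (topple G s v c))"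
    by (rule toppling.intros)
qed

text \<open>Toppling one vertex never takes grains from another, so topplings at distinct vertices
  commute and every fork closes in at most one step per side.\<close>

lemma confluentp_toppling: "confluentp (toppling G s)"
proof (rule strong_confluentp_imp_confluentp, rule strong_confluentpI)
  fix x y z assume "toppling G s x y" "toppling G s x z"
  then obtain v w where
    v: "v \<in> nonsink G s" "out_degree G v \<le> x v" "y = topple G s v x" and
    w: "w \<in> nonsink G s" "out_degree G w \<le> x w" "z = topple G s w x"
    by (auto elim!: toppling.cases)
  show "\<exists>u. (toppling G s)\<^sup>*\<^sup>* y u \<and> (toppling G s)\<^sup>=\<^sup>= z u"
  proof (cases "v = w")
    case False
    then have "toppling G s y (topple G s w y)" "toppling G s z (topple G s w y)"
      using toppling_commute[of v w x] toppling_commute[of w v x] v w by auto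
    then show ?thesis by blast
  qed (use v w in auto)
qed

text \<open>Stable configurations are normal forms, so two of them with a common reduct
  coincide.\<close>

lemma stabilization_unique:
  assumes "(toppling G s)\<^sup>*\<^sup>* c d" "stable G s d" "(toppling G s)\<^sup>*\<^sup>* c d'" "stable G s d'"
  shows "d = d'"
proof -
  obtain u where "(toppling G s)\<^sup>*\<^sup>* d u" "(toppling G s)\<^sup>*\<^sup>* d' u"
    using confluentpD[OF confluentp_toppling] assms by blast
  then show ?thesis using assms stable_no_toppling by (metis converse_rtranclpE)
qed

lemma stabilization_exists: "\<exists>d. (toppling G s)\<^sup>*\<^sup>* c d \<and> stable G s d"
proof (induction c rule: wfp_induct_rule[OF toppling_terminates])
  case (1 c)
  show ?case
  proof (cases "stable G s c")
    case False
    then obtain v where "v \<in> nonsink G s" "out_degree G v \<le> c v"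
      by (auto simp: stable_def not_less)
    then have "toppling G s c (topple G s v c)" by (rule toppling.intros)
    then show ?thesis using 1 by (meson converse_rtranclp_into_rtranclp)
  qed auto
qed

lemma stabilization_eqI:
  assumes "(toppling G s)\<^sup>*\<^sup>* c d" "stable G s d"
  shows "stabilization G s c = d"
  unfolding stabilization_def using assms stabilization_unique by blast

lemma toppling_stabilization: "(toppling G s)\<^sup>*\<^sup>* c (stabilization G s c)"
  and stable_stabilization: "stable G s (stabilization G s c)"
  using stabilization_exists[of c] stabilization_eqI[of c] by auto

lemma stabilization_toppling:
  assumes "(toppling G s)\<^sup>*\<^sup>* c d"
  shows "stabilization G s c = stabilization G s d"
  using assms toppling_stabilization[of d] stable_stabilization[of d]
  by (intro stabilization_eqI) auto

lemma toppling_configurations: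
  assumes "(toppling G s)\<^sup>*\<^sup>* c d" "c \<in> configurations G s"
  shows "d \<in> configurations G s"
  using assms
proof (induction rule: rtranclp_induct)
  case (step y z)
  from step.hyps(2) show ?case by cases (simp add: configurations_def topple_def)
qed

text \<open>Extra grains never make a legal toppling illegal. That \<open>x\<close> vanishes off the
  non-sink vertices matters, as \<open>topple\<close> sets the values there to 0.\<close>

lemma toppling_add:
  assumes "(toppling G s)\<^sup>*\<^sup>* c d" and x: "x \<in> configurations G s"
  shows "(toppling G s)\<^sup>*\<^sup>* (\<lambda>v. c v + x v) (\<lambda>v. d v + x v)"
  using assms(1)
proof (induction rule: rtranclp_induct)
  case (step y z)
  from step.hyps(2) have "toppling G s (\<lambda>v. y v + x v) (\<lambda>v. z v + x v)"
  proof cases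
    case (1 v)
    have "topple G s v (\<lambda>v. y v + x v) = (\<lambda>v. z v + x v)"
      using 1 x by (auto simp: topple_def fun_eq_iff configurations_def)
    then show ?thesis using toppling.intros[of v G s "\<lambda>v. y v + x v"] 1 by simp
  qed
  then show ?case using step.IH by simp
qed simp

section \<open>The sandpile monoid\<close>

lemma carrier_sandpile: "carrier \<M> = {c \<in> configurations G s. stable G s c}"
  and mult_sandpile: "a \<otimes>\<^bsub>\<M>\<^esub> b = stabilization G s (\<lambda>v. a v + b v)"
  and one_sandpile: "\<one>\<^bsub>\<M>\<^esub> = (\<lambda>v. 0)"
  by (simp_all add: sandpile_monoid_def)

lemma toppling_mult: "(toppling G s)\<^sup>*\<^sup>* (\<lambda>v. a v + b v) (a \<otimes>\<^bsub>\<M>\<^esub> b)"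
  by (simp add: mult_sandpile toppling_stabilization)

lemma add_configurations:
  "a \<in> configurations G s \<Longrightarrow> b \<in> configurations G s \<Longrightarrow> (\<lambda>v. a v + b v) \<in> configurations G s"
  by (simp add: configurations_def)

lemma comm_monoid_sandpile: "comm_monoid \<M>"
proof (rule comm_monoidI)
  fix a b assume "a \<in> carrier \<M>" "b \<in> carrier \<M>"
  then have "(\<lambda>v. a v + b v) \<in> configurations G s"
    by (simp add: carrier_sandpile add_configurations)
  then show "a \<otimes>\<^bsub>\<M>\<^esub> b \<in> carrier \<M>"
    using toppling_configurations toppling_stabilization stable_stabilization
    unfolding carrier_sandpile mult_sandpile by blast
next
  show "\<one>\<^bsub>\<M>\<^esub> \<in> carrier \<M>"
    by (simp add: carrier_sandpile one_sandpile configurations_def stable_def out_degree_pos)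
next
  \<comment> \<open>Stabilizing a partial sum first is a partial toppling of the whole sum, so both
    bracketings have the stabilization of the sum of all three.\<close>
  have assoc: "stabilization G s (\<lambda>v. (a \<otimes>\<^bsub>\<M>\<^esub> b) v + c v) = stabilization G s (\<lambda>v. a v + b v + c v)"
    if "c \<in> carrier \<M>" for a b c
    using toppling_add[OF toppling_mult[of a b], of c] that
    by (intro stabilization_toppling[symmetric]) (auto simp: carrier_sandpile)
  fix a b c assume abc: "a \<in> carrier \<M>" "b \<in> carrier \<M>" "c \<in> carrier \<M>"
  have "a \<otimes>\<^bsub>\<M>\<^esub> b \<otimes>\<^bsub>\<M>\<^esub> c = stabilization G s (\<lambda>v. a v + b v + c v)"
    using assoc[OF abc(3)] by (simp add: mult_sandpile)
  moreover have "a \<otimes>\<^bsub>\<M>\<^esub> (b \<otimes>\<^bsub>\<M>\<^esub> c) = stabilization G s (\<lambda>v. b v + c v + a v)"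
    using assoc[OF abc(1), of b c] by (simp add: mult_sandpile add.commute)
  ultimately show "a \<otimes>\<^bsub>\<M>\<^esub> b \<otimes>\<^bsub>\<M>\<^esub> c = a \<otimes>\<^bsub>\<M>\<^esub> (b \<otimes>\<^bsub>\<M>\<^esub> c)"
    by (simp add: algebra_simps)
next
  fix a b show "a \<otimes>\<^bsub>\<M>\<^esub> b = b \<otimes>\<^bsub>\<M>\<^esub> a" by (simp add: mult_sandpile add.commute)
next
  fix a assume "a \<in> carrier \<M>"
  then show "\<one>\<^bsub>\<M>\<^esub> \<otimes>\<^bsub>\<M>\<^esub> a = a"
    by (auto simp: mult_sandpile one_sandpile carrier_sandpile intro!: stabilization_eqI)
qed

text \<open>Stability bounds every value by \<open>card (arcs G)\<close>, and the support lies in a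
  finite set.\<close>

lemma finite_sandpile: "finite (carrier \<M>)"
proof (rule finite_subset)
  let ?D = "card (arcs G)"
  have D: "out_degree G v \<le> ?D" for v
    unfolding out_degree_def by (intro card_mono) (auto simp: out_arcs_def)
  have "c v \<le> ?D" if "stable G s c" "v \<in> nonsink G s" for c v
    using that D[of v] unfolding stable_def by (meson less_imp_le_nat less_le_trans)
  then show "carrier \<M> \<subseteq>
      {c. \<forall>v. (v \<in> nonsink G s \<longrightarrow> c v \<in> {..?D}) \<and> (v \<notin> nonsink G s \<longrightarrow> c v = 0)}"
    by (auto simp: carrier_sandpile configurations_def)
  show "finite {c. \<forall>v. (v \<in> nonsink G s \<longrightarrow> c v \<in> {..?D}) \<and> (v \<notin> nonsink G s \<longrightarrow> c v = 0)}"
    by (rule finite_set_of_finite_funs) auto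
qed

section \<open>Sand on vertices with an accessible cycle\<close>

lemma feeds_cycle_backward:
  assumes "v \<rightarrow> w" "v \<noteq> s" "w \<noteq> s" "feeds_cycle w"
  shows "feeds_cycle v"
proof -
  have "v \<rightarrow>\<^bsub>del_vert s\<^esub> w" using assms by (simp add: dominates_del_sink_iff)
  then show ?thesis
    using assms(4) by (rule wf_digraph.cycle_accessible_backward[OF wf_digraph_del_vert])
qed

lemma feeds_cycle_forward:
  assumes "feeds_cycle v"
  shows "\<exists>w\<in>nonsink G s. v \<rightarrow> w \<and> feeds_cycle w"
proof -
  obtain w where "v \<rightarrow>\<^bsub>del_vert s\<^esub> w" "feeds_cycle w"
    using assms wf_digraph.cycle_accessible_forward[OF wf_digraph_del_vert] by blast
  then show ?thesis by (auto simp: dominates_del_sink_iff adj_in_verts)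
qed

text \<open>When a vertex that feeds a cycle topples, some successor also feeds a cycle and receives
  a grain; toppling any other vertex takes no sand from it.\<close>

lemma toppling_keeps_cyclic_sand:
  assumes "(toppling G s)\<^sup>*\<^sup>* c d" and "\<exists>v\<in>nonsink G s. 0 < c v \<and> feeds_cycle v"
  shows "\<exists>v\<in>nonsink G s. 0 < d v \<and> feeds_cycle v"
  using assms
proof (induction rule: rtranclp_induct)
  case (step y z)
  then obtain v where v: "v \<in> nonsink G s" "0 < y v" "feeds_cycle v" by blast
  from step.hyps(2) show ?case
  proof cases
    case (1 u)
    show ?thesis
    proof (cases "u = v")
      case True
      obtain w where w: "w \<in> nonsink G s" "v \<rightarrow> w" "feeds_cycle w"
        using feeds_cycle_forward[OF v(3)] by blast
      then have "0 < arc_count v w" by (simp only: arc_count_pos_iff)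
      then have "0 < z w" using 1 True w by (simp add: topple_def)
      then show ?thesis using w by blast
    next
      case False
      then have "0 < z v" using 1 v by (simp add: topple_def)
      then show ?thesis using v by blast
    qed
  qed
qed

lemma pow_keeps_cyclic_sand:
  assumes "\<exists>v\<in>nonsink G s. 0 < a v \<and> feeds_cycle v" and "n \<ge> 1"
  shows "\<exists>v\<in>nonsink G s. 0 < (a [^]\<^bsub>\<M>\<^esub> (n::nat)) v \<and> feeds_cycle v"
proof -
  obtain m where n: "n = Suc m" using assms(2) by (cases n) auto
  have "\<exists>v\<in>nonsink G s. 0 < (a [^]\<^bsub>\<M>\<^esub> m) v + a v \<and> feeds_cycle v" using assms(1) by auto
  then show ?thesis unfolding n nat_pow_Suc
    by (rule toppling_keeps_cyclic_sand[OF toppling_mult])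
qed

section \<open>Sand away from accessible cycles\<close>

text \<open>\<open>T\<close> counts the topplings at each vertex, and the equation is conservation
  of grains. Vertices that feed a cycle hold no sand, so they do not topple, and no arc leads to
  them from a vertex that does.\<close>

lemma toppling_acyclic_balance:
  assumes "(toppling G s)\<^sup>*\<^sup>* c d" and "\<forall>v\<in>nonsink G s. feeds_cycle v \<longrightarrow> c v = 0"
  shows "(\<forall>v\<in>nonsink G s. feeds_cycle v \<longrightarrow> d v = 0) \<and>
    (\<exists>T. (\<forall>v\<in>nonsink G s. feeds_cycle v \<longrightarrow> T v = 0) \<and>
      (\<forall>w\<in>nonsink G s. d w + T w * out_degree G w
         = c w + (\<Sum>v\<in>nonsink G s. T v * arc_count v w)))"
  using assms
proof (induction rule: rtranclp_induct)
  case base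
  then show ?case by (auto intro!: exI[of _ "\<lambda>_. 0"])
next
  case (step y z)
  then obtain T where y: "\<forall>v\<in>nonsink G s. feeds_cycle v \<longrightarrow> y v = 0"
    and T0: "\<forall>v\<in>nonsink G s. feeds_cycle v \<longrightarrow> T v = 0"
    and T: "\<forall>w\<in>nonsink G s. y w + T w * out_degree G w
         = c w + (\<Sum>v\<in>nonsink G s. T v * arc_count v w)" by blast
  from step.hyps(2) show ?case
  proof cases
    case (1 u)
    have "0 < y u" using 1 out_degree_pos[of u] by simp
    then have u: "\<not> feeds_cycle u" using y 1 by auto
    have "z w = 0" if w: "w \<in> nonsink G s" "feeds_cycle w" for w
    proof -
      have "\<not> u \<rightarrow> w" using feeds_cycle_backward u w 1 by blast
      then have "arc_count u w = 0" using arc_count_pos_iff[of u w] by (metis gr0I)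
      then show ?thesis using 1 w y u by (auto simp: topple_def)
    qed
    moreover have "z w + (T(u := Suc (T u))) w * out_degree G w
        = c w + (\<Sum>v\<in>nonsink G s. (T(u := Suc (T u))) v * arc_count v w)"
      if w: "w \<in> nonsink G s" for w
    proof -
      have "(\<Sum>v\<in>nonsink G s. (T(u := Suc (T u))) v * arc_count v w)
          = (\<Sum>v\<in>nonsink G s. T v * arc_count v w + (if v = u then arc_count u w else 0))"
        by (intro sum.cong) auto
      also have "\<dots> = (\<Sum>v\<in>nonsink G s. T v * arc_count v w) + arc_count u w"
        using 1 by (simp add: sum.distrib)
      finally have S: "(\<Sum>v\<in>nonsink G s. (T(u := Suc (T u))) v * arc_count v w)
          = (\<Sum>v\<in>nonsink G s. T v * arc_count v w) + arc_count u w" .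
      show ?thesis unfolding S using T w 1 by (auto simp: topple_def)
    qed
    ultimately show ?thesis using T0 u by (intro conjI exI[of _ "T(u := Suc (T u))"]) auto
  qed
qed

lemma pow_acyclic:
  assumes "\<forall>v\<in>nonsink G s. feeds_cycle v \<longrightarrow> a v = 0"
  shows "\<forall>v\<in>nonsink G s. feeds_cycle v \<longrightarrow> (a [^]\<^bsub>\<M>\<^esub> (n::nat)) v = 0"
proof (induction n)
  case 0
  show ?case by (simp add: one_sandpile)
next
  case (Suc n)
  then have "\<forall>v\<in>nonsink G s. feeds_cycle v \<longrightarrow> (a [^]\<^bsub>\<M>\<^esub> n) v + a v = 0" using assms by simp
  then show ?case unfolding nat_pow_Suc
    using toppling_acyclic_balance[OF toppling_mult[of "a [^]\<^bsub>\<M>\<^esub> n" a]] by blast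
qed

text \<open>A closed walk in the relation would give its start an accessible cycle; being finite and
  acyclic, the relation is well-founded, and induction along it runs from the sources on.\<close>

lemma wf_acyclic_part:
  "wf {(v, w). v \<rightarrow>\<^bsub>del_vert s\<^esub> w \<and> \<not> feeds_cycle v}" (is "wf ?R")
proof (rule finite_acyclic_wf)
  have "?R \<subseteq> verts G \<times> verts G" by (auto simp: dominates_del_sink_iff adj_in_verts)
  then show "finite ?R" by (rule finite_subset) simp
  show "acyclic ?R"
  proof (rule acyclicI, intro allI notI)
    fix x assume x: "(x, x) \<in> ?R\<^sup>+"
    then have "\<not> feeds_cycle x" by (auto dest!: tranclD)
    moreover have "?R \<subseteq> arcs_ends (del_vert s)" by auto
    then have xx: "x \<rightarrow>\<^sup>+\<^bsub>del_vert s\<^esub> x" using x trancl_mono by blast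
    then have "x \<rightarrow>\<^sup>*\<^bsub>del_vert s\<^esub> x" by (rule wf_digraph.reachable1_reachable[OF wf_digraph_del_vert])
    then have "feeds_cycle x"
      using xx wf_digraph.cycle_accessible_iff[OF wf_digraph_del_vert] by blast
    ultimately show False by simp
  qed
qed

text \<open>Let \<open>T\<close> count the topplings from \<open>f + f\<close> to \<open>f\<close>.
  By induction from the sources no grains flow into \<open>w\<close>, so the balance reads
  \<open>T w * out_degree G w = f w\<close>; stability, \<open>f w < out_degree G w\<close>, forces
  both \<open>T w\<close> and \<open>f w\<close> to vanish.\<close>

lemma acyclic_idempotent_zero:
  assumes f: "f \<in> idempotents \<M>" and supp: "\<forall>v\<in>nonsink G s. feeds_cycle v \<longrightarrow> f v = 0"
  shows "f = \<one>\<^bsub>\<M>\<^esub>"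
proof -
  have fc: "f \<in> configurations G s" "stable G s f" and "f \<otimes>\<^bsub>\<M>\<^esub> f = f"
    using f by (auto simp: idempotents_def carrier_sandpile)
  then have "(toppling G s)\<^sup>*\<^sup>* (\<lambda>v. f v + f v) f" using toppling_mult[of f f] by simp
  moreover have "\<forall>v\<in>nonsink G s. feeds_cycle v \<longrightarrow> f v + f v = 0" using supp by simp
  ultimately obtain T where T0: "\<forall>v\<in>nonsink G s. feeds_cycle v \<longrightarrow> T v = 0"
    and T: "\<forall>w\<in>nonsink G s. f w + T w * out_degree G w
         = f w + f w + (\<Sum>v\<in>nonsink G s. T v * arc_count v w)"
    using toppling_acyclic_balance by blast
  have "w \<in> nonsink G s \<longrightarrow> f w = 0 \<and> T w = 0" for w
  proof (induction w rule: wf_induct_rule[OF wf_acyclic_part])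
    case (1 w)
    show ?case
    proof
      assume w: "w \<in> nonsink G s"
      have "T v * arc_count v w = 0" if v: "v \<in> nonsink G s" for v
      proof (cases "v \<rightarrow> w")
        case True
        then have "v \<rightarrow>\<^bsub>del_vert s\<^esub> w" using v w by (simp add: dominates_del_sink_iff)
        \<comment> \<open>Either \<open>v\<close> feeds a cycle and never topples, or it precedes
          \<open>w\<close> and the induction hypothesis applies.\<close>
        then have "T v = 0" using 1 v T0 by blast
        then show ?thesis by simp
      next
        case False
        then have "arc_count v w = 0" using arc_count_pos_iff[of v w] by (metis gr0I)
        then show ?thesis by simp
      qed
      then have eq: "T w * out_degree G w = f w" using T w by simp
      moreover have "f w < out_degree G w" using fc w by (simp add: stable_def)
      ultimately have "T w = 0" by (cases "T w") auto
      then show "f w = 0 \<and> T w = 0" using eq by simp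
    qed
  qed
  then show ?thesis using fc by (auto simp: one_sandpile configurations_def)
qed

end

theorem theorem4p3:
  fixes G :: "('a, 'b) pre_digraph" and s :: 'a and a :: "'a \<Rightarrow> nat"
  assumes "sandpile_graph G s"
    and "card (idempotents (sandpile_monoid G s)) = 2"
    and "a \<in> carrier (sandpile_monoid G s)"
  shows "((\<exists>v \<in> nonsink G s. 0 < a v \<and> cycle_accessible_from (pre_digraph.del_vert G s) v) \<longrightarrow>
            (\<exists>n \<ge> 1. recurrent (sandpile_monoid G s) (a [^]\<^bsub>sandpile_monoid G s\<^esub> (n::nat))))
       \<and> ((\<forall>v \<in> nonsink G s. cycle_accessible_from (pre_digraph.del_vert G s) v \<longrightarrow> a v = 0) \<longrightarrow>
            (\<forall>n \<ge> 1. \<not> recurrent (sandpile_monoid G s) (a [^]\<^bsub>sandpile_monoid G s\<^esub> (n::nat))))"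
proof -
  interpret sandpile_graph G s by fact
  interpret M: comm_monoid \<M> by (rule comm_monoid_sandpile)
  note two = M.two_idempotents_recurrent[OF finite_sandpile assms(2)]
  show ?thesis
  proof (intro conjI impI allI notI)
    assume cyc: "\<exists>v \<in> nonsink G s. 0 < a v \<and> feeds_cycle v"
    obtain n :: nat where n: "n \<ge> 1" "a [^]\<^bsub>\<M>\<^esub> n \<in> idempotents \<M>"
      using M.exists_idempotent_pow[OF finite_sandpile assms(3)] by blast
    \<comment> \<open>Toppling has kept a grain somewhere, while the identity is the empty
      configuration.\<close>
    have "a [^]\<^bsub>\<M>\<^esub> n \<noteq> \<one>\<^bsub>\<M>\<^esub>"
      using pow_keeps_cyclic_sand[OF cyc n(1)] by (auto simp: one_sandpile)
    then show "\<exists>n\<ge>1. recurrent \<M> (a [^]\<^bsub>\<M>\<^esub> (n::nat))" using two(2) n by blast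
  next
    fix n :: nat
    assume acyc: "\<forall>v \<in> nonsink G s. feeds_cycle v \<longrightarrow> a v = 0"
      and rec: "recurrent \<M> (a [^]\<^bsub>\<M>\<^esub> n)"
    \<comment> \<open>An idempotent power of the recurrent term is again recurrent, yet has no sand
      on a vertex that feeds a cycle, so it is the identity, which is not recurrent.\<close>
    obtain k :: nat where k: "k \<ge> 1" "(a [^]\<^bsub>\<M>\<^esub> n) [^]\<^bsub>\<M>\<^esub> k \<in> idempotents \<M>"
      using M.exists_idempotent_pow[OF finite_sandpile, of "a [^]\<^bsub>\<M>\<^esub> n"] assms(3) by auto
    have "(a [^]\<^bsub>\<M>\<^esub> n) [^]\<^bsub>\<M>\<^esub> k = \<one>\<^bsub>\<M>\<^esub>"
      using k(2) by (rule acyclic_idempotent_zero) (rule pow_acyclic[OF pow_acyclic[OF acyc]])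
    then show False using M.recurrent_pow[OF rec k(1)] two(1) by simp
  qed
qed

end
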